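(* In the setting of the context, let $u\in\mathcal B$ and, for $k\in\{1,\dots,q\}$, let $b^{(k)}\in\mathbb R^{\mathcal I^{(k)}}$ be defined by $b^{(k)}_i:=\langle\psi^{(k)}_i,u\rangle$. Let $w^{(1)}\in\mathbb R^{\mathcal I^{(1)}}$ be the solution of $A^{(1)}w^{(1)}=b^{(1)}$ and $v^{(1)}:=\sum_{i\in\mathcal I^{(1)}}w^{(1)}_i\psi^{(1)}_i$. For $k\in\{2,\dots,q\}$ let $w^{(k)}\in\mathbb R^{\mathcal J^{(k)}}$ be the solution of $B^{(k)}w^{(k)}=W^{(k)}b^{(k)}$ and $v^{(k)}:=\sum_{i\in\mathcal J^{(k)}}w^{(k)}_i\chi^{(k)}_i$. Then $$u^{(q)}(u)=\sum_{k=1}^qv^{(k)}.$$ Furthermore $v^{(1)}=u^{(1)}(u)$ and, for $k\in\{2,\dots,q\}$, $v^{(k)}=u^{(k)}(u)-u^{(k-1)}(u)$.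
   Context: $(\mathcal B,\|\cdot\|)$ is a reflexive separable Banach space with dual $\mathcal B^*$ and dual pairing $[\cdot,\cdot]$, whose norm is quadratic: $\|u\|^2=[Q^{-1}u,u]$, where $Q:\mathcal B^*\to\mathcal B$ is a symmetric positive bijective linear operator. $\langle u,v\rangle:=[Q^{-1}u,v]$. Let $q\in\mathbb N^*\cup\{\infty\}$ and let $\mathcal I^{(q)}$ be an index tree of depth $q$, i.e. a finite set of $q$-tuples; for a tuple $i$ of length $\geq k$, $i^{(k)}:=(i_1,\dots,i_k)$, and $\mathcal I^{(k)}:=\{i^{(k)}:i\in\mathcal I^{(q)}\}$. For $k\in\{1,\dots,q-1\}$, $\pi^{(k,k+1)}$ is an $\mathcal I^{(k)}\times\mathcal I^{(k+1)}$ matrix of rank $|\mathcal I^{(k)}|$. $(\phi^{(q)}_i)_{i\in\mathcal I^{(q)}}$ are linearly independent elements of $\mathcal B^*$ and, for $k\in\{1,\dots,q-1\}$, $\phi^{(k)}_i=\sum_{j\in\mathcal I^{(k+1)}}\pi^{(k,k+1)}_{i,j}\phi^{(k+1)}_j$. Gamblets: for $i\in\mathcal I^{(k)}$, $\psi^{(k)}_i$ is the minimizer of $\|\psi\|$ over $\psi\in\mathcal B$ subject to $[\phi^{(k)}_j,\psi]=\delta_{i,j}$ for $j\in\mathcal I^{(k)}$. $u^{(k)}(u):=\sum_{i\in\mathcal I^{(k)}}[\phi^{(k)}_i,u]\psi^{(k)}_i$. For $k\in\{2,\dots,q\}$, $\mathcal J^{(k)}$ is a finite set of $k$-tuples with $\{j^{(k-1)}:j\in\mathcal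 J^{(k)}\}=\mathcal I^{(k-1)}$ and, for $i\in\mathcal I^{(k-1)}$, $\#\{j\in\mathcal J^{(k)}:j^{(k-1)}=i\}=\#\{t\in\mathcal I^{(k)}:t^{(k-1)}=i\}-1$. $W^{(k)}$ is a $\mathcal J^{(k)}\times\mathcal I^{(k)}$ matrix with $\operatorname{Im}(W^{(k),T})=\operatorname{Ker}(\pi^{(k-1,k)})$. $\chi^{(k)}_i:=\sum_{j\in\mathcal I^{(k)}}W^{(k)}_{i,j}\psi^{(k)}_j$ for $i\in\mathcal J^{(k)}$. $A^{(k)}_{i,j}=\langle\psi^{(k)}_i,\psi^{(k)}_j\rangle$ and $B^{(k)}_{i,j}=\langle\chi^{(k)}_i,\chi^{(k)}_j\rangle$. When $q=\infty$, the ranges of $k$ are read as all finite levels, $\mathcal I^{(\infty)}$ is a set of infinite sequences with every $\mathcal I^{(k)}$ finite, $(\phi^{(k)}_i)_{i\in\mathcal I^{(k)}}$, $k\ge1$, are families in $\mathcal B^*$, linearly independent for each $k$, satisfying the nesting relation for every $k\ge1$; $u^{(\infty)}(u)=\lim_ku^{(k)}(u)$ and the sum over $k$ is a convergent series in $\mathcal B$. *)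

theory Defs
  imports
    "HOL-Analysis.Analysis"
    "HOL-Library.Extended_Nat"
    "HOL-Library.Function_Algebras"
begin

section \<open>Reflexive Banach spaces with a quadratic norm\<close>

type_synonym 'a dual = "'a \<Rightarrow>\<^sub>L real"

definition reflexive_space :: "'a::real_normed_vector itself \<Rightarrow> bool" where
  "reflexive_space _ \<longleftrightarrow>
     (\<forall>F :: 'a dual \<Rightarrow>\<^sub>L real. \<exists>u :: 'a. \<forall>f :: 'a dual. blinfun_apply F f = blinfun_apply f u)"

definition quadratic_norm :: "('a::real_normed_vector dual \<Rightarrow> 'a) \<Rightarrow> bool" where
  "quadratic_norm Q \<longleftrightarrow>
     linear Q \<and> bij Q \<and>
     (\<forall>f g. blinfun_apply f (Q g) = blinfun_apply g (Q f)) \<and>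
     (\<forall>f. 0 \<le> blinfun_apply f (Q f)) \<and>
     (\<forall>u. (norm u)\<^sup>2 = blinfun_apply (inv Q u) u)"

definition energy_inner :: "('a::real_normed_vector dual \<Rightarrow> 'a) \<Rightarrow> 'a \<Rightarrow> 'a \<Rightarrow> real" where
  "energy_inner Q u v = blinfun_apply (inv Q u) v"

definition lin_indep_family :: "'b set \<Rightarrow> ('b \<Rightarrow> 'v::real_vector) \<Rightarrow> bool" where
  "lin_indep_family S f \<longleftrightarrow> inj_on f S \<and> independent (f ` S)"

section \<open>Index trees\<close>

text \<open>A q-tuple, with q finite or infinite, is a function on the positions
  1, ..., q (all positive positions if q is infinite), extended by \<^term>\<open>undefined\<close> so that
  equality of functions is equality of tuples.\<close>

definition tuples :: "enat \<Rightarrow> (nat \<Rightarrow> 'i) set" where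
  "tuples q = extensional {l. 1 \<le> l \<and> enat l \<le> q}"

definition trunc :: "nat \<Rightarrow> (nat \<Rightarrow> 'i) \<Rightarrow> nat \<Rightarrow> 'i" where
  "trunc k i = restrict i {1..k}"

definition level :: "(nat \<Rightarrow> 'i) set \<Rightarrow> nat \<Rightarrow> (nat \<Rightarrow> 'i) set" where
  "level I k = trunc k ` I"

text \<open>For finite q, level q of a set of q-tuples is the set itself, so the finiteness condition
  says that the tree is finite; for infinite q it says that every finite level is finite.\<close>

definition index_tree :: "enat \<Rightarrow> (nat \<Rightarrow> 'i) set \<Rightarrow> bool" where
  "index_tree q I \<longleftrightarrow> I \<subseteq> tuples q \<and> (\<forall>k\<ge>1. enat k \<le> q \<longrightarrow> finite (level I k))"

section \<open>Matrices indexed by finite sets\<close>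

text \<open>An \<open>R \<times> C\<close> matrix is a function of two indices of which only the entries with row index in
  \<open>R\<close> and column index in \<open>C\<close> are used. Vectors indexed by \<open>S\<close> are functions vanishing
  outside \<open>S\<close>.\<close>

definition coord_space :: "'b set \<Rightarrow> ('b \<Rightarrow> real) set" where
  "coord_space S = {x. \<forall>i. i \<notin> S \<longrightarrow> x i = 0}"

definition fmat_apply ::
  "'b set \<Rightarrow> 'c set \<Rightarrow> ('b \<Rightarrow> 'c \<Rightarrow> real) \<Rightarrow> ('c \<Rightarrow> real) \<Rightarrow> 'b \<Rightarrow> real" where
  "fmat_apply R C M x = (\<lambda>i. if i \<in> R then (\<Sum>j\<in>C. M i j * x j) else 0)"

definition fmat_image :: "'b set \<Rightarrow> 'c set \<Rightarrow> ('b \<Rightarrow> 'c \<Rightarrow> real) \<Rightarrow> ('b \<Rightarrow> real) set" where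
  "fmat_image R C M = fmat_apply R C M ` coord_space C"

definition fmat_kernel :: "'b set \<Rightarrow> 'c set \<Rightarrow> ('b \<Rightarrow> 'c \<Rightarrow> real) \<Rightarrow> ('c \<Rightarrow> real) set" where
  "fmat_kernel R C M = {x \<in> coord_space C. fmat_apply R C M x = (\<lambda>_. 0)}"

definition fmat_transpose :: "('b \<Rightarrow> 'c \<Rightarrow> real) \<Rightarrow> 'c \<Rightarrow> 'b \<Rightarrow> real" where
  "fmat_transpose M = (\<lambda>j i. M i j)"

definition fmat_rank :: "'b set \<Rightarrow> 'c set \<Rightarrow> ('b \<Rightarrow> 'c \<Rightarrow> real) \<Rightarrow> nat" where
  "fmat_rank R C M = vector_space.dim (\<lambda>(c::real) x i. c * x i) (fmat_image R C M)"

definition fmat_solution :: "'b set \<Rightarrow> ('b \<Rightarrow> 'b \<Rightarrow> real) \<Rightarrow> ('b \<Rightarrow> real) \<Rightarrow> 'b \<Rightarrow> real" where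
  "fmat_solution S M b =
     (THE w. w \<in> coord_space S \<and> (\<forall>i\<in>S. (\<Sum>j\<in>S. M i j * w j) = b i))"

section \<open>Gamblets\<close>

definition gamblet ::
  "'b set \<Rightarrow> ('b \<Rightarrow> 'a::real_normed_vector dual) \<Rightarrow> 'b \<Rightarrow> 'a" where
  "gamblet S \<phi> i =
     (THE \<psi>. is_arg_min norm
        (\<lambda>\<psi>. \<forall>j\<in>S. blinfun_apply (\<phi> j) \<psi> = (if i = j then 1 else 0)) \<psi>)"

definition gamblet_approx ::
  "'b set \<Rightarrow> ('b \<Rightarrow> 'a::real_normed_vector dual) \<Rightarrow> 'a \<Rightarrow> 'a" where
  "gamblet_approx S \<phi> u = (\<Sum>i\<in>S. blinfun_apply (\<phi> i) u *\<^sub>R gamblet S \<phi> i)"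

definition measurement_hierarchy ::
  "enat \<Rightarrow> (nat \<Rightarrow> 'i) set \<Rightarrow> (nat \<Rightarrow> (nat \<Rightarrow> 'i) \<Rightarrow> (nat \<Rightarrow> 'i) \<Rightarrow> real)
     \<Rightarrow> (nat \<Rightarrow> (nat \<Rightarrow> 'i) \<Rightarrow> 'a::real_normed_vector dual) \<Rightarrow> bool" where
  "measurement_hierarchy q I \<pi> \<phi> \<longleftrightarrow>
     (\<forall>k\<ge>1. enat k < q \<longrightarrow>
        fmat_rank (level I k) (level I (Suc k)) (\<pi> k) = card (level I k) \<and>
        (\<forall>i\<in>level I k. \<phi> k i = (\<Sum>j\<in>level I (Suc k). \<pi> k i j *\<^sub>R \<phi> (Suc k) j))) \<and>
     (case q of
        enat n \<Rightarrow> lin_indep_family (level I n) (\<phi> n)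
      | \<infinity> \<Rightarrow> (\<forall>k\<ge>1. lin_indep_family (level I k) (\<phi> k)))"

text \<open>In the cardinality condition every \<open>i\<close> has at least one child in the tree, so the
  subtraction of natural numbers does not truncate.\<close>

definition orthogonalization_system ::
  "enat \<Rightarrow> (nat \<Rightarrow> 'i) set \<Rightarrow> (nat \<Rightarrow> (nat \<Rightarrow> 'i) \<Rightarrow> (nat \<Rightarrow> 'i) \<Rightarrow> real)
     \<Rightarrow> (nat \<Rightarrow> (nat \<Rightarrow> 'i) set) \<Rightarrow> (nat \<Rightarrow> (nat \<Rightarrow> 'i) \<Rightarrow> (nat \<Rightarrow> 'i) \<Rightarrow> real) \<Rightarrow> bool" where
  "orthogonalization_system q I \<pi> J W \<longleftrightarrow>
     (\<forall>k\<ge>2. enat k \<le> q \<longrightarrow>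
        finite (J k) \<and> J k \<subseteq> tuples (enat k) \<and>
        trunc (k - 1) ` J k = level I (k - 1) \<and>
        (\<forall>i\<in>level I (k - 1).
           card {j \<in> J k. trunc (k - 1) j = i} =
           card {t \<in> level I k. trunc (k - 1) t = i} - 1) \<and>
        fmat_image (level I k) (J k) (fmat_transpose (W k)) =
        fmat_kernel (level I (k - 1)) (level I k) (\<pi> (k - 1)))"

end

theory Submission
  imports Defs
begin

text \<open>Let \<open>V\<^sub>k\<close> be the span of the vectors \<open>Q \<phi>\<^sup>k\<^sub>i\<close>. Since \<open>Q \<phi>\<close> represents \<open>\<phi>\<close> in the energy inner
  product, the gamblets of level \<open>k\<close> are the basis of \<open>V\<^sub>k\<close> dual to the measurements, and
  \<open>u\<^sup>k(u)\<close> is the orthogonal projection \<open>P\<^sub>k u\<close> of \<open>u\<close> onto \<open>V\<^sub>k\<close>. The nesting relation gives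
  \<open>V\<^sub>k\<^sub>-\<^sub>1 \<subseteq> V\<^sub>k\<close>, and the image condition on \<open>W\<^sup>k\<close> says that the vectors \<open>\<chi>\<^sup>k\<^sub>i\<close> span the
  orthogonal complement of \<open>V\<^sub>k\<^sub>-\<^sub>1\<close> in \<open>V\<^sub>k\<close>; counting dimensions, they are linearly independent.
  Each linear system is the Gram system of an orthogonal projection, so \<open>v\<^sup>k\<close> is the projection
  of \<open>u\<close> onto the span of the \<open>\<chi>\<^sup>k\<^sub>i\<close>, that is \<open>P\<^sub>k u - P\<^sub>k\<^sub>-\<^sub>1 u\<close>, and the sum telescopes. For
  infinite depth, \<open>\<parallel>P\<^sub>k u\<parallel>\<close> is increasing and bounded by \<open>\<parallel>u\<parallel>\<close>, so by Pythagoras \<open>P\<^sub>k u\<close> is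
  Cauchy.\<close>

section \<open>Linear independence of finite families and row rank\<close>

lemma sum_fun_apply: "(\<Sum>i\<in>S. f i) x = (\<Sum>i\<in>S. f i x :: real)"
  by (induction S rule: infinite_finite_induct) auto

lemma sum_coord_unit:
  assumes "finite S"
  shows "(\<Sum>j\<in>S. (if j = i then 1 else 0 :: real) *\<^sub>R f j) = (if i \<in> S then f i else (0::'v::real_vector))"
proof -
  have "(\<Sum>j\<in>S. (if j = i then 1 else 0 :: real) *\<^sub>R f j) = (\<Sum>j\<in>S. if j = i then f j else 0)"
    by (intro sum.cong) auto
  then show ?thesis using assms by simp
qed

text \<open>The coefficients are made to vanish outside \<open>S\<close>, so that they can serve as
  the unique vector demanded by \<open>fmat_solution\<close>.\<close>

lemma span_imageE:
  fixes f :: "'b \<Rightarrow> 'v::real_vector"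
  assumes "finite S" "x \<in> span (f ` S)"
  obtains a where "a \<in> coord_space S" "x = (\<Sum>i\<in>S. a i *\<^sub>R f i)"
proof -
  have "\<exists>a. a \<in> coord_space S \<and> x = (\<Sum>i\<in>S. a i *\<^sub>R f i)"
    using assms(2)
  proof (induction rule: span_induct_alt)
    case base
    show ?case by (rule exI[of _ "\<lambda>_. 0"]) (auto simp: coord_space_def)
  next
    case (step c y z)
    then obtain i a where i: "i \<in> S" "y = f i" and a: "a \<in> coord_space S" "z = (\<Sum>i\<in>S. a i *\<^sub>R f i)"
      by auto
    let ?a = "\<lambda>j. c * (if j = i then 1 else 0) + a j"
    have "(\<Sum>j\<in>S. ?a j *\<^sub>R f j) = c *\<^sub>R (\<Sum>j\<in>S. (if j = i then 1 else 0 :: real) *\<^sub>R f j) + z"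
      unfolding a(2) scaleR_left_distrib sum.distrib scaleR_sum_right by simp
    also have "\<dots> = c *\<^sub>R y + z"
      using i assms(1) by (simp only: sum_coord_unit if_True)
    finally show ?case
      using i a(1) by (intro exI[of _ ?a]) (auto simp: coord_space_def)
  qed
  then show thesis using that by blast
qed

lemma sum_in_span_image: "(\<Sum>i\<in>S. a i *\<^sub>R f i) \<in> span (f ` S)"
  by (intro span_sum span_scale span_base) auto

lemma lin_indep_family_iff:
  fixes f :: "'b \<Rightarrow> 'v::real_vector"
  assumes S: "finite S"
  shows "lin_indep_family S f \<longleftrightarrow> (\<forall>a. (\<Sum>i\<in>S. a i *\<^sub>R f i) = 0 \<longrightarrow> (\<forall>i\<in>S. a i = 0))"
proof (intro iffI allI impI ballI)
  fix a i
  assume f: "lin_indep_family S f" and 0: "(\<Sum>i\<in>S. a i *\<^sub>R f i) = 0" and i: "i \<in> S"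
  from f have inj: "inj_on f S" and ind: "independent (f ` S)"
    by (auto simp: lin_indep_family_def)
  have "(\<Sum>x\<in>f ` S. a (inv_into S f x) *\<^sub>R x) = 0"
    using inj 0 by (simp add: sum.reindex)
  from independentD[OF ind _ _ this, of "f i"] show "a i = 0"
    using inj i S by simp
next
  assume a: "\<forall>a. (\<Sum>i\<in>S. a i *\<^sub>R f i) = 0 \<longrightarrow> (\<forall>i\<in>S. a i = 0)"
  have inj: "inj_on f S"
  proof (rule inj_onI, rule ccontr)
    fix i j assume ij: "i \<in> S" "j \<in> S" "f i = f j" "i \<noteq> j"
    \<comment> \<open>A repeated value \<open>f i = f j\<close> counts as a dependence: this is the
      difference of two coordinate vectors, a nontrivial relation.\<close>
    let ?a = "\<lambda>l. (if l = i then 1 else 0) - (if l = j then 1 else 0) :: real"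
    have "(\<Sum>l\<in>S. ?a l *\<^sub>R f l) = f i - f j"
      unfolding scaleR_left_diff_distrib sum_subtractf sum_coord_unit[OF S] using ij by simp
    with ij a[rule_format, of ?a i] show False by simp
  qed
  have "independent (f ` S)"
  proof (rule independent_if_scalars_zero)
    fix g x assume "(\<Sum>x\<in>f ` S. g x *\<^sub>R x) = 0" "x \<in> f ` S"
    then show "g x = 0" using a[rule_format, of "g \<circ> f"] inj by (auto simp: sum.reindex)
  qed (use S in auto)
  with inj show "lin_indep_family S f" by (simp add: lin_indep_family_def)
qed

lemma lin_indep_familyD:
  fixes f :: "'b \<Rightarrow> 'v::real_vector"
  assumes "lin_indep_family S f" "finite S" "(\<Sum>i\<in>S. a i *\<^sub>R f i) = 0" "i \<in> S"
  shows "a i = 0"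
  using assms lin_indep_family_iff by blast

text \<open>By Steinitz exchange, a maximal independent subset \<open>B\<close> of \<open>f\<close>
  S\<open>has at least\<close>card T\<open>elements, hence at least\<close>card
  S\<open>. So\<close>B\<open>is all of\<close>f \<open>S\<close> and no two indices share a
  value.\<close>

lemma lin_indep_family_if_spans:
  fixes f :: "'b \<Rightarrow> 'v::real_vector"
  assumes "finite S" "g ` T \<subseteq> span (f ` S)" "lin_indep_family T g" "card S \<le> card T"
  shows "lin_indep_family S f"
proof -
  obtain B where B: "B \<subseteq> f ` S" "independent B" "f ` S \<subseteq> span B"
    using maximal_independent_subset[of "f ` S"] by blast
  have fB: "finite B" using B(1) assms(1) finite_subset by blast
  have "span (f ` S) \<subseteq> span B" by (rule span_minimal[OF B(3) subspace_span])
  then have "card (g ` T) \<le> card B"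
    using independent_span_bound[OF fB, of "g ` T"] assms(2,3) by (auto simp: lin_indep_family_def)
  moreover have "card (g ` T) = card T"
    using assms(3) by (auto simp: lin_indep_family_def card_image)
  moreover have "card B \<le> card (f ` S)" "card (f ` S) \<le> card S"
    using B(1) assms(1) by (auto intro: card_mono card_image_le)
  ultimately have "card B = card (f ` S)" "card (f ` S) = card S"
    using assms(4) by auto
  then show ?thesis
    using B assms(1) card_subset_eq[of "f ` S" B] by (auto simp: lin_indep_family_def eq_card_imp_inj_on)
qed

text \<open>The disjoint sum joins families with different index types into one, where a vector
  occurring in both would count as a dependence.\<close>

lemma lin_indep_family_Plus_left:
  fixes f :: "'b \<Rightarrow> 'v::real_vector" and g :: "'c \<Rightarrow> 'v"
  assumes "lin_indep_family (S <+> T) (case_sum f g)"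
  shows "lin_indep_family S f"
proof -
  have "case_sum f g ` Inl ` S = f ` S" by force
  moreover have "inj_on f S"
  proof (rule inj_onI)
    fix i j assume ij: "i \<in> S" "j \<in> S" "f i = f j"
    have "(Inl i :: 'b + 'c) = Inl j"
      by (rule inj_onD[of "case_sum f g" "S <+> T"]) (use assms ij in \<open>auto simp: lin_indep_family_def\<close>)
    then show "i = j" by simp
  qed
  moreover have "case_sum f g ` Inl ` S \<subseteq> case_sum f g ` (S <+> T)" by (auto simp: Plus_def)
  ultimately show ?thesis
    using assms independent_mono unfolding lin_indep_family_def by metis
qed

text \<open>The image is a subspace of the coordinate space over \<open>R\<close> and has its full
  dimension, so the two coincide.\<close>

lemma fmat_full_row_rank_surj:
  fixes M :: "'b \<Rightarrow> 'c \<Rightarrow> real"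
  assumes R: "finite R" and rank: "fmat_rank R C M = card R" and x: "x \<in> coord_space R"
  shows "x \<in> fmat_image R C M"
proof -
  \<comment> \<open>\<open>fmat_rank\<close> measures dimension with this explicit pointwise
    scaling, so the dimension theory is instantiated for the same operation.\<close>
  interpret fv: vector_space "\<lambda>(c::real) (x::'b \<Rightarrow> real) i. c * x i"
    by unfold_locales (auto simp: fun_eq_iff algebra_simps)
  let ?e = "\<lambda>i j :: 'b. if j = i then 1 else 0 :: real"
  have units: "y \<in> fv.span (?e ` R)" if y: "y \<in> coord_space R" for y
  proof -
    have "(\<Sum>i\<in>R. (\<lambda>j. y i * ?e i j)) \<in> fv.span (?e ` R)"
      by (intro fv.span_sum fv.span_scale fv.span_base) auto
    moreover have "y = (\<Sum>i\<in>R. (\<lambda>j. y i * ?e i j))"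
    proof
      fix j
      show "y j = (\<Sum>i\<in>R. (\<lambda>j. y i * ?e i j)) j"
        using R y by (simp add: sum_fun_apply coord_space_def if_distrib cong: if_cong)
    qed
    ultimately show ?thesis by simp
  qed
  have sub: "fv.subspace (fmat_image R C M)"
  proof (rule fv.subspaceI)
    show "0 \<in> fmat_image R C M"
      unfolding fmat_image_def
      by (rule image_eqI[of _ _ "0"]) (auto simp: fmat_apply_def coord_space_def)
  next
    fix y z assume "y \<in> fmat_image R C M" "z \<in> fmat_image R C M"
    then obtain s t where "s \<in> coord_space C" "t \<in> coord_space C"
      "y = fmat_apply R C M s" "z = fmat_apply R C M t"
      by (auto simp: fmat_image_def)
    then show "y + z \<in> fmat_image R C M"
      unfolding fmat_image_def
      by (intro image_eqI[of _ _ "s + t"])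
        (auto simp: fmat_apply_def coord_space_def fun_eq_iff distrib_left sum.distrib)
  next
    fix c y assume "y \<in> fmat_image R C M"
    then obtain s where "s \<in> coord_space C" "y = fmat_apply R C M s"
      by (auto simp: fmat_image_def)
    then show "(\<lambda>i. c * y i) \<in> fmat_image R C M"
      unfolding fmat_image_def
      by (intro image_eqI[of _ _ "\<lambda>j. c * s j"])
        (auto simp: fmat_apply_def coord_space_def fun_eq_iff sum_distrib_left algebra_simps)
  qed
  obtain B where B: "B \<subseteq> fmat_image R C M" "fv.independent B"
    "fmat_image R C M \<subseteq> fv.span B" "card B = fv.dim (fmat_image R C M)"
    using fv.basis_exists by blast
  have BR: "B \<subseteq> coord_space R"
    using B(1) by (auto simp: fmat_image_def fmat_apply_def coord_space_def)
  have cB: "card B = card R" using B(4) rank by (simp add: fmat_rank_def)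
  \<comment> \<open>Otherwise \<open>insert x B\<close> would consist of \<open>card R + 1\<close>
    independent vectors in the span of at most \<open>card R\<close> unit vectors.\<close>
  have "x \<in> fv.span B"
  proof (rule ccontr)
    assume nx: "x \<notin> fv.span B"
    have ins: "fv.independent (insert x B)" using B(2) nx by (rule fv.independent_insertI[rotated])
    have "insert x B \<subseteq> fv.span (?e ` R)" using x BR units by auto
    then have "finite (insert x B)" "card (insert x B) \<le> card (?e ` R)"
      using fv.independent_span_bound[of "?e ` R", OF _ ins] R by auto
    moreover have "card (?e ` R) \<le> card R" by (rule card_image_le[OF R])
    moreover have "x \<notin> B" using nx fv.span_base by blast
    ultimately show False using cB by simp
  qed
  also have "fv.span B \<subseteq> fmat_image R C M" by (rule fv.span_minimal[OF B(1) sub])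
  finally show ?thesis .
qed

text \<open>A relation \<open>a\<close> among the \<open>g i\<close> gives, by independence of
  \<open>f\<close>, a row vector with \<open>a M = 0\<close>. Solving \<open>M y = e_l\<close> by
  surjectivity yields \<open>a l = a M y = 0\<close>.\<close>

lemma lin_indep_family_fmat:
  fixes f :: "'c \<Rightarrow> 'v::real_vector"
  assumes R: "finite R" and C: "finite C" and rank: "fmat_rank R C M = card R"
    and f: "lin_indep_family C f" and g: "\<And>i. i \<in> R \<Longrightarrow> g i = (\<Sum>j\<in>C. M i j *\<^sub>R f j)"
  shows "lin_indep_family R g"
  unfolding lin_indep_family_iff[OF R]
proof (intro allI impI ballI)
  fix a l assume 0: "(\<Sum>i\<in>R. a i *\<^sub>R g i) = 0" and l: "l \<in> R"
  have "(\<Sum>i\<in>R. a i *\<^sub>R g i) = (\<Sum>i\<in>R. \<Sum>j\<in>C. (a i * M i j) *\<^sub>R f j)"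
    by (intro sum.cong) (auto simp: g scaleR_sum_right)
  also have "\<dots> = (\<Sum>j\<in>C. (\<Sum>i\<in>R. a i * M i j) *\<^sub>R f j)"
    by (subst sum.swap) (simp add: scaleR_sum_left)
  finally have col: "(\<Sum>i\<in>R. a i * M i j) = 0" if "j \<in> C" for j
    using lin_indep_familyD[OF f C _ that] 0 by auto
  let ?e = "\<lambda>i. if i = l then 1 else 0 :: real"
  have "?e \<in> coord_space R" using l by (auto simp: coord_space_def)
  from fmat_full_row_rank_surj[OF R rank this] obtain y where y: "?e = fmat_apply R C M y"
    by (auto simp: fmat_image_def)
  have "a l = (\<Sum>i\<in>R. a i * ?e i)" using R l by (simp add: if_distrib cong: if_cong)
  also have "\<dots> = (\<Sum>i\<in>R. a i * fmat_apply R C M y i)" by (simp flip: y)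
  also have "\<dots> = (\<Sum>i\<in>R. \<Sum>j\<in>C. a i * (M i j * y j))"
    by (intro sum.cong) (auto simp: fmat_apply_def sum_distrib_left)
  also have "\<dots> = (\<Sum>j\<in>C. (\<Sum>i\<in>R. a i * M i j) * y j)"
    by (subst sum.swap) (simp add: sum_distrib_right mult.assoc)
  also have "\<dots> = 0" using col by simp
  finally show "a l = 0" .
qed

section \<open>Orthogonal projections for the energy inner product\<close>

locale quadratic_space =
  fixes Q :: "'a::real_normed_vector dual \<Rightarrow> 'a"
  assumes quadratic: "quadratic_norm Q"
begin

abbreviation ip :: "'a \<Rightarrow> 'a \<Rightarrow> real" where "ip \<equiv> energy_inner Q"

lemma linear_Q: "linear Q" and bij_Q: "bij Q"
  and Q_sym: "blinfun_apply f (Q g) = blinfun_apply g (Q f)"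
  and norm_eq: "(norm u)\<^sup>2 = ip u u"
  using quadratic by (auto simp: quadratic_norm_def energy_inner_def)

text \<open>\<open>Q\<close> is the Riesz map: \<open>Q f\<close> represents \<open>f\<close>, so
  measurements become inner products.\<close>

lemma ip_Q: "ip (Q f) x = blinfun_apply f x"
  using bij_Q by (simp add: energy_inner_def bij_is_inj)

lemma ip_commute: "ip x y = ip y x"
  by (metis Q_sym bij_Q bij_is_surj ip_Q surj_def)

lemma ip_right [simp]:
  "ip x (y + z) = ip x y + ip x z" "ip x (y - z) = ip x y - ip x z" "ip x (c *\<^sub>R y) = c * ip x y"
  "ip x 0 = 0" "ip x (- y) = - ip x y" "ip x (\<Sum>i\<in>S. h i) = (\<Sum>i\<in>S. ip x (h i))"
  by (simp_all add: energy_inner_def blinfun.bilinear_simps)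

lemma ip_left [simp]:
  "ip (y + z) x = ip y x + ip z x" "ip (y - z) x = ip y x - ip z x" "ip (c *\<^sub>R y) x = c * ip y x"
  "ip 0 x = 0" "ip (- y) x = - ip y x" "ip (\<Sum>i\<in>S. h i) x = (\<Sum>i\<in>S. ip (h i) x)"
  by (simp_all add: ip_commute[of _ x])

lemma ip_zero_iff [simp]: "ip x x = 0 \<longleftrightarrow> x = 0"
  by (simp flip: norm_eq)

text \<open>Orthogonality of \<open>u - p\<close> to \<open>V\<close>, written as equal inner
  products. Being a relation, it lets existence and uniqueness be treated separately.\<close>

definition orth_proj :: "'a set \<Rightarrow> 'a \<Rightarrow> 'a \<Rightarrow> bool" where
  "orth_proj V u p \<longleftrightarrow> p \<in> V \<and> (\<forall>t\<in>V. ip t p = ip t u)"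

lemma orth_proj_unique:
  assumes "subspace V" "orth_proj V u p" "orth_proj V u p'"
  shows "p = p'"
proof -
  have "p - p' \<in> V" using assms by (auto simp: orth_proj_def intro: subspace_diff)
  then have "ip (p - p') (p - p') = 0" using assms by (simp add: orth_proj_def)
  then show ?thesis unfolding ip_zero_iff by simp
qed

lemma orth_proj_spanI:
  assumes "p \<in> span T" "\<And>t. t \<in> T \<Longrightarrow> ip t p = ip t u"
  shows "orth_proj (span T) u p"
  unfolding orth_proj_def
proof (intro conjI ballI)
  fix t assume "t \<in> span T"
  then show "ip t p = ip t u"
    by (induction rule: span_induct_alt) (use assms(2) in auto)
qed fact

text \<open>One Gram-Schmidt step per generator: \<open>d\<close> is the part of \<open>a\<close>
  orthogonal to the earlier span, and the component of \<open>u\<close> along \<open>d\<close> is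
  added to \<open>p\<close>.\<close>

lemma orth_proj_exists:
  assumes "finite T"
  shows "\<exists>p. orth_proj (span T) u p"
  using assms
proof (induction T arbitrary: u)
  case empty
  show ?case by (auto simp: orth_proj_def)
next
  case (insert a T)
  obtain p where p: "orth_proj (span T) u p" using insert by blast
  obtain r where r: "orth_proj (span T) a r" using insert by blast
  have Tp: "ip t p = ip t u" and Tr: "ip t r = ip t a" if "t \<in> span T" for t
    using p r that by (auto simp: orth_proj_def)
  have mem: "p \<in> span T" "r \<in> span T" using p r by (auto simp: orth_proj_def)
  define d where "d = a - r"
  \<comment> \<open>If \<open>a\<close> already lies in the span of \<open>T\<close>, then
    \<open>d = 0\<close>; division by zero gives \<open>c = 0\<close>, which is the right
    value.\<close>
  define c where "c = ip d u / ip d d"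
  have dT: "ip t d = 0" if "t \<in> span T" for t
    using Tr[OF that] by (simp add: d_def)
  have "orth_proj (span (insert a T)) u (p + c *\<^sub>R d)"
  proof (rule orth_proj_spanI)
    have "span T \<subseteq> span (insert a T)" by (intro span_mono) auto
    with mem show "p + c *\<^sub>R d \<in> span (insert a T)"
      unfolding d_def by (intro span_add span_scale span_diff) (auto intro: span_base)
  next
    fix t assume t: "t \<in> insert a T"
    have T': "ip t (p + c *\<^sub>R d) = ip t u" if "t \<in> span T" for t
      using dT[OF that] Tp[OF that] by simp
    have "ip d (p + c *\<^sub>R d) = ip d u"
      using dT[OF mem(1)] by (auto simp: ip_commute[of d p] c_def)
    then have "ip a (p + c *\<^sub>R d) = ip a u"
      using T'[OF mem(2)] by (simp add: d_def algebra_simps)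
    with t T' show "ip t (p + c *\<^sub>R d) = ip t u" by (auto intro: span_base)
  qed
  then show ?case by blast
qed

lemma orth_proj_pythagoras:
  assumes "orth_proj V u p"
  shows "(norm u)\<^sup>2 = (norm p)\<^sup>2 + (norm (u - p))\<^sup>2"
proof -
  have "ip p u = ip p p" using assms by (auto simp: orth_proj_def)
  then show ?thesis unfolding norm_eq by (simp add: ip_commute[of u p])
qed

lemma orth_proj_mono:
  assumes "V' \<subseteq> V" "orth_proj V u p" "orth_proj V' u p'"
  shows "orth_proj V' p p'"
  using assms unfolding orth_proj_def by (metis subsetD)

text \<open>The coefficients of the projection solve the Gram system; conversely every solution
  yields the projection, and independence of \<open>f\<close> makes its coefficients unique. So the
  definite description in \<open>fmat_solution\<close> is well defined.\<close>

lemma orth_proj_gram: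
  assumes S: "finite S" and f: "lin_indep_family S f"
    and M: "\<And>i j. i \<in> S \<Longrightarrow> j \<in> S \<Longrightarrow> M i j = ip (f i) (f j)"
    and c: "\<And>i. i \<in> S \<Longrightarrow> c i = ip (f i) u"
  shows "orth_proj (span (f ` S)) u (\<Sum>i\<in>S. fmat_solution S M c i *\<^sub>R f i)"
proof -
  obtain p where p: "orth_proj (span (f ` S)) u p"
    using orth_proj_exists[of "f ` S"] S by blast
  then have "p \<in> span (f ` S)" by (simp add: orth_proj_def)
  then obtain a where a: "a \<in> coord_space S" "p = (\<Sum>i\<in>S. a i *\<^sub>R f i)"
    using span_imageE S by blast
  have gram: "(\<Sum>j\<in>S. M i j * w j) = ip (f i) (\<Sum>j\<in>S. w j *\<^sub>R f j)" if "i \<in> S" for i w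
    using M that by (simp add: mult.commute)
  have "fmat_solution S M c = a"
    unfolding fmat_solution_def
  proof (rule the_equality)
    show "a \<in> coord_space S \<and> (\<forall>i\<in>S. (\<Sum>j\<in>S. M i j * a j) = c i)"
    proof (intro conjI ballI)
      fix i assume i: "i \<in> S"
      then have "f i \<in> span (f ` S)" by (auto intro: span_base)
      then show "(\<Sum>j\<in>S. M i j * a j) = c i"
        using p i by (simp add: gram c orth_proj_def flip: a(2))
    qed fact
  next
    fix w assume w: "w \<in> coord_space S \<and> (\<forall>i\<in>S. (\<Sum>j\<in>S. M i j * w j) = c i)"
    have "orth_proj (span (f ` S)) u (\<Sum>j\<in>S. w j *\<^sub>R f j)"
    proof (rule orth_proj_spanI[OF sum_in_span_image])
      fix t assume "t \<in> f ` S"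
      then show "ip t (\<Sum>j\<in>S. w j *\<^sub>R f j) = ip t u"
        using w gram c by auto
    qed
    from orth_proj_unique[OF subspace_span this p]
    have "(\<Sum>j\<in>S. (w j - a j) *\<^sub>R f j) = 0"
      by (simp add: a(2) scaleR_left_diff_distrib sum_subtractf)
    from lin_indep_familyD[OF f S this] have "w j = a j" if "j \<in> S" for j
      using that by simp
    then show "w = a" using w a(1) by (force simp: coord_space_def fun_eq_iff)
  qed
  with p a(2) show ?thesis by simp
qed

lemma orth_proj_nested_dist:
  assumes "V' \<subseteq> V" "orth_proj V u p" "orth_proj V' u p'"
  shows "(norm (p - p'))\<^sup>2 = (norm p)\<^sup>2 - (norm p')\<^sup>2"
  using orth_proj_pythagoras[OF orth_proj_mono[OF assms]] by simp

text \<open>Squared distances between the projections are differences of a bounded increasing real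
  sequence, so the Cauchy property of that sequence transfers.\<close>

lemma Cauchy_orth_proj:
  assumes mono: "\<And>n. V n \<subseteq> V (Suc n)" and p: "\<And>n. orth_proj (V n) u (p n)"
  shows "Cauchy p"
proof -
  have sub: "V m \<subseteq> V n" if "m \<le> n" for m n
    using lift_Suc_mono_le[of V, OF mono that] .
  let ?s = "\<lambda>n. (norm (p n))\<^sup>2"
  have dist: "(norm (p n - p m))\<^sup>2 = ?s n - ?s m" if "m \<le> n" for m n
    by (rule orth_proj_nested_dist[OF sub[OF that] p p])
  have "incseq ?s"
  proof (rule incseq_SucI)
    fix n show "?s n \<le> ?s (Suc n)"
      using dist[of n "Suc n"] zero_le_power2[of "norm (p (Suc n) - p n)"] by linarith
  qed
  moreover have "?s n \<le> (norm u)\<^sup>2" for n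
    using orth_proj_pythagoras[OF p[of n]] by simp
  ultimately obtain L where "?s \<longlonglongrightarrow> L" using incseq_convergent by blast
  then have C: "Cauchy ?s" by (intro convergent_Cauchy convergentI)
  show ?thesis
  proof (rule metric_CauchyI)
    fix e :: real assume "e > 0"
    then have "e\<^sup>2 > 0" by simp
    from metric_CauchyD[OF C this] obtain N
      where N: "\<And>m n. m \<ge> N \<Longrightarrow> n \<ge> N \<Longrightarrow> \<bar>?s m - ?s n\<bar> < e\<^sup>2"
      by (auto simp: dist_real_def)
    have ord: "norm (p n - p m) < e" if "N \<le> m" "m \<le> n" for m n
    proof -
      have "(norm (p n - p m))\<^sup>2 < e\<^sup>2"
        using N[of n m] dist[OF that(2)] that by simp
      then show ?thesis using \<open>e > 0\<close> by (simp add: power_less_imp_less_base)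
    qed
    show "\<exists>M. \<forall>m\<ge>M. \<forall>n\<ge>M. dist (p m) (p n) < e"
    proof (intro exI allI impI)
      fix m n assume "m \<ge> N" "n \<ge> N"
      then show "dist (p m) (p n) < e"
        using ord[of m n] ord[of n m] by (cases "m \<le> n") (auto simp: dist_norm norm_minus_commute)
    qed
  qed
qed

section \<open>Gamblets as dual bases\<close>

abbreviation meas_space :: "'b set \<Rightarrow> ('b \<Rightarrow> 'a dual) \<Rightarrow> 'a set" where
  "meas_space S \<phi> \<equiv> span ((\<lambda>i. Q (\<phi> i)) ` S)"

text \<open>Equal measurements are equal inner products with the spanning vectors, so
  \<open>x\<close> and \<open>y\<close> are both the projection of \<open>y\<close>.\<close>

lemma meas_space_eqI:
  assumes "x \<in> meas_space S \<phi>" "y \<in> meas_space S \<phi>"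
    and "\<And>j. j \<in> S \<Longrightarrow> blinfun_apply (\<phi> j) x = blinfun_apply (\<phi> j) y"
  shows "x = y"
proof (rule orth_proj_unique[OF subspace_span])
  show "orth_proj (meas_space S \<phi>) y x"
    by (rule orth_proj_spanI) (use assms in \<open>auto simp: ip_Q\<close>)
  show "orth_proj (meas_space S \<phi>) y y"
    using assms by (simp add: orth_proj_def)
qed

lemma lin_indep_family_Q:
  assumes S: "finite S" and \<phi>: "lin_indep_family S \<phi>"
  shows "lin_indep_family S (\<lambda>i. Q (\<phi> i))"
  unfolding lin_indep_family_iff[OF S]
proof (intro allI impI ballI)
  fix a i assume "(\<Sum>i\<in>S. a i *\<^sub>R Q (\<phi> i)) = 0" and i: "i \<in> S"
  then have "Q (\<Sum>i\<in>S. a i *\<^sub>R \<phi> i) = Q 0"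
    using linear_Q by (simp add: linear_sum linear_scale linear_0)
  then have "(\<Sum>i\<in>S. a i *\<^sub>R \<phi> i) = 0" using bij_Q by (meson bij_is_inj injD)
  then show "a i = 0" using lin_indep_familyD[OF \<phi> S] i by blast
qed

text \<open>The dual basis vector is the component of \<^term>\<open>Q (\<phi> i)\<close> orthogonal to the other
  \<^term>\<open>Q (\<phi> j)\<close>, normalized.\<close>

lemma dual_basis_exists:
  assumes S: "finite S" and \<phi>: "lin_indep_family S \<phi>" and i: "i \<in> S"
  shows "\<exists>x\<in>meas_space S \<phi>. \<forall>j\<in>S. blinfun_apply (\<phi> j) x = (if i = j then 1 else 0)"
proof -
  let ?T = "(\<lambda>i. Q (\<phi> i)) ` (S - {i})"
  obtain p where p: "orth_proj (span ?T) (Q (\<phi> i)) p"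
    using orth_proj_exists[of ?T] S by blast
  define d where "d = Q (\<phi> i) - p"
  have pT: "p \<in> span ?T" using p by (simp add: orth_proj_def)
  have orth: "ip t d = 0" if "t \<in> span ?T" for t
    using p that by (simp add: d_def orth_proj_def)
  have "d \<noteq> 0"
  proof
    assume "d = 0"
    then have "Q (\<phi> i) \<in> span ?T" using pT by (simp add: d_def)
    \<comment> \<open>Injectivity of the family guarantees that dropping the index \<open>i\<close>
      drops exactly the vector \<open>Q (\<phi> i)\<close>.\<close>
    moreover have "?T = (\<lambda>i. Q (\<phi> i)) ` S - {Q (\<phi> i)}"
      using lin_indep_family_Q[OF S \<phi>] i by (auto simp: lin_indep_family_def inj_on_def)
    ultimately show False
      using lin_indep_family_Q[OF S \<phi>] i by (auto simp: lin_indep_family_def dependent_def)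
  qed
  then have dd: "ip d d \<noteq> 0" by simp
  have "span ?T \<subseteq> meas_space S \<phi>" by (intro span_mono) auto
  then have "d \<in> meas_space S \<phi>"
    unfolding d_def using pT i by (intro span_diff) (auto intro: span_base)
  moreover have "blinfun_apply (\<phi> j) ((1 / ip d d) *\<^sub>R d) = (if i = j then 1 else 0)" if j: "j \<in> S" for j
  proof (cases "i = j")
    case True
    have "ip (Q (\<phi> j)) d = ip d d" using orth[OF pT] True by (simp add: d_def ip_commute)
    then show ?thesis using dd True by (simp add: ip_Q blinfun.scaleR_right)
  next
    case False
    then have "ip (Q (\<phi> j)) d = 0" using j by (intro orth span_base) auto
    then show ?thesis using False by (simp add: ip_Q blinfun.scaleR_right)
  qed
  ultimately show ?thesis by (meson span_scale)
qed

text \<open>Every \<open>y\<close> satisfying the constraints projects onto the dual basis vector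
  \<open>x\<close>. Pythagoras makes \<open>x\<close> a minimizer, and the remainder
  \<open>y - x\<close> must vanish for any other minimizer.\<close>

lemma gamblet_props:
  assumes S: "finite S" and \<phi>: "lin_indep_family S \<phi>" and i: "i \<in> S"
  shows gamblet_in_meas_space: "gamblet S \<phi> i \<in> meas_space S \<phi>"
    and gamblet_biorthogonal:
      "\<And>j. j \<in> S \<Longrightarrow> blinfun_apply (\<phi> j) (gamblet S \<phi> i) = (if i = j then 1 else 0)"
proof -
  let ?P = "\<lambda>y. \<forall>j\<in>S. blinfun_apply (\<phi> j) y = (if i = j then 1 else 0)"
  obtain x where x: "x \<in> meas_space S \<phi>" "?P x"
    using dual_basis_exists[OF assms] by blast
  have pyth: "(norm y)\<^sup>2 = (norm x)\<^sup>2 + (norm (y - x))\<^sup>2" if y: "?P y" for y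
  proof (rule orth_proj_pythagoras)
    show "orth_proj (meas_space S \<phi>) y x"
      by (rule orth_proj_spanI) (use x y in \<open>auto simp: ip_Q\<close>)
  qed
  have min: "norm x \<le> norm y" if "?P y" for y
  proof (rule power2_le_imp_le)
    show "(norm x)\<^sup>2 \<le> (norm y)\<^sup>2" unfolding pyth[OF that] by simp
  qed simp
  have "gamblet S \<phi> i = x"
    unfolding gamblet_def
  proof (rule the_equality)
    show "is_arg_min norm ?P x"
      using x(2) min by (force simp: is_arg_min_def)
  next
    fix y assume y: "is_arg_min norm ?P y"
    then have "norm y \<le> norm x" using x(2) by (force simp: is_arg_min_def)
    moreover have Py: "?P y" using y by (simp add: is_arg_min_def)
    ultimately have "norm x = norm y" using min by force
    then have "(norm (y - x))\<^sup>2 = 0" using pyth[OF Py] by simp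
    then show "y = x" by simp
  qed
  with x show "gamblet S \<phi> i \<in> meas_space S \<phi>"
    "\<And>j. j \<in> S \<Longrightarrow> blinfun_apply (\<phi> j) (gamblet S \<phi> i) = (if i = j then 1 else 0)"
    by auto
qed

lemma gamblet_sum_in_meas_space:
  assumes S: "finite S" and \<phi>: "lin_indep_family S \<phi>"
  shows "(\<Sum>i\<in>S. a i *\<^sub>R gamblet S \<phi> i) \<in> meas_space S \<phi>"
  by (intro span_sum span_scale gamblet_in_meas_space assms)

lemma measure_gamblet_sum:
  fixes \<phi> :: "'b \<Rightarrow> 'a dual"
  assumes S: "finite S" and \<phi>: "lin_indep_family S \<phi>" and j: "j \<in> S"
  shows "blinfun_apply (\<phi> j) (\<Sum>i\<in>S. a i *\<^sub>R gamblet S \<phi> i) = a j"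
proof -
  have "blinfun_apply (\<phi> j) (\<Sum>i\<in>S. a i *\<^sub>R gamblet S \<phi> i) = (\<Sum>i\<in>S. a i * (if i = j then 1 else 0))"
    unfolding blinfun.sum_right blinfun.scaleR_right
    by (intro sum.cong) (use gamblet_biorthogonal[OF S \<phi>] j in auto)
  then show ?thesis using S j by (simp add: if_distrib cong: if_cong)
qed

lemma lin_indep_family_gamblet:
  fixes \<phi> :: "'b \<Rightarrow> 'a dual"
  assumes S: "finite S" and \<phi>: "lin_indep_family S \<phi>"
  shows "lin_indep_family S (gamblet S \<phi>)"
  unfolding lin_indep_family_iff[OF S]
proof (intro allI impI ballI)
  fix a i assume 0: "(\<Sum>i\<in>S. a i *\<^sub>R gamblet S \<phi> i) = 0" and i: "i \<in> S"
  show "a i = 0" using measure_gamblet_sum[OF S \<phi> i, of a] 0 by (simp add: blinfun.zero_right)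
qed

lemma gamblet_approx_of_meas_space:
  assumes S: "finite S" and \<phi>: "lin_indep_family S \<phi>" and x: "x \<in> meas_space S \<phi>"
  shows "gamblet_approx S \<phi> x = x"
  unfolding gamblet_approx_def
  by (rule meas_space_eqI[OF gamblet_sum_in_meas_space[OF S \<phi>] x])
    (use measure_gamblet_sum[OF S \<phi>] in auto)

lemma span_gamblet:
  assumes S: "finite S" and \<phi>: "lin_indep_family S \<phi>"
  shows "span (gamblet S \<phi> ` S) = meas_space S \<phi>"
proof
  show "span (gamblet S \<phi> ` S) \<subseteq> meas_space S \<phi>"
    by (intro span_minimal) (use gamblet_in_meas_space[OF S \<phi>] in auto)
  show "meas_space S \<phi> \<subseteq> span (gamblet S \<phi> ` S)"
  proof
    fix x assume "x \<in> meas_space S \<phi>"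
    then have "gamblet_approx S \<phi> x = x" by (rule gamblet_approx_of_meas_space[OF S \<phi>])
    then show "x \<in> span (gamblet S \<phi> ` S)"
      unfolding gamblet_approx_def by (metis sum_in_span_image)
  qed
qed

text \<open>By biorthogonality the approximation reproduces the measurements of \<open>u\<close>,
  which are its inner products with the spanning vectors.\<close>

lemma orth_proj_gamblet_approx:
  assumes S: "finite S" and \<phi>: "lin_indep_family S \<phi>"
  shows "orth_proj (meas_space S \<phi>) u (gamblet_approx S \<phi> u)"
  unfolding gamblet_approx_def
  by (rule orth_proj_spanI[OF gamblet_sum_in_meas_space[OF S \<phi>]])
    (use measure_gamblet_sum[OF S \<phi>] in \<open>auto simp: ip_Q simp del: ip_right\<close>)

lemma meas_space_mono:
  assumes "\<And>i. i \<in> R \<Longrightarrow> \<phi>' i = (\<Sum>j\<in>C. M i j *\<^sub>R \<phi> j)"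
  shows "meas_space R \<phi>' \<subseteq> meas_space C \<phi>"
proof (rule span_minimal[OF _ subspace_span], safe)
  fix i assume "i \<in> R"
  then have "Q (\<phi>' i) = (\<Sum>j\<in>C. M i j *\<^sub>R Q (\<phi> j))"
    using assms linear_Q by (simp add: linear_sum linear_scale)
  then show "Q (\<phi>' i) \<in> meas_space C \<phi>"
    by (simp add: sum_in_span_image)
qed

end

section \<open>Passing from one level to the next\<close>

text \<open>Two consecutive levels, detached from the tree: \<open>R\<close> is the coarse and
  \<open>C\<close> the fine index set. The condition \<open>cards\<close> condenses the fibrewise
  count of children into the dimension of the orthogonal complement.\<close>

locale gamblet_step = quadratic_space Q for Q :: "'a::real_normed_vector dual \<Rightarrow> 'a" +
  fixes R :: "'b set" and C :: "'c set" and J :: "'d set"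
    and M :: "'b \<Rightarrow> 'c \<Rightarrow> real" and W :: "'d \<Rightarrow> 'c \<Rightarrow> real"
    and \<phi>' :: "'b \<Rightarrow> 'a dual" and \<phi> :: "'c \<Rightarrow> 'a dual"
  assumes R: "finite R" and C: "finite C" and J: "finite J"
    and \<phi>': "lin_indep_family R \<phi>'" and \<phi>: "lin_indep_family C \<phi>"
    and nested: "\<And>i. i \<in> R \<Longrightarrow> \<phi>' i = (\<Sum>j\<in>C. M i j *\<^sub>R \<phi> j)"
    and cards: "card J + card R = card C"
    and image_eq_kernel: "fmat_image C J (fmat_transpose W) = fmat_kernel R C M"
begin

definition chi :: "'d \<Rightarrow> 'a" where
  "chi i = (\<Sum>j\<in>C. W i j *\<^sub>R gamblet C \<phi> j)"

lemma chi_in_meas_space: "chi i \<in> meas_space C \<phi>"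
  unfolding chi_def by (rule gamblet_sum_in_meas_space[OF C \<phi>])

text \<open>Row \<open>l\<close> of \<open>W\<close> is the image of a unit vector under the
  transpose, hence lies in the kernel of \<open>M\<close>. Thus \<open>chi l\<close> is orthogonal
  to the coarse space.\<close>

lemma measure_chi:
  assumes i: "i \<in> R" and l: "l \<in> J"
  shows "blinfun_apply (\<phi>' i) (chi l) = 0"
proof -
  let ?e = "\<lambda>j. if j = l then 1 else 0 :: real"
  have "?e \<in> coord_space J" using l by (auto simp: coord_space_def)
  then have ker: "fmat_apply C J (fmat_transpose W) ?e \<in> fmat_kernel R C M"
    unfolding image_eq_kernel[symmetric] fmat_image_def by blast
  have row: "fmat_apply C J (fmat_transpose W) ?e j = W l j" if "j \<in> C" for j
    using that l J by (simp add: fmat_apply_def fmat_transpose_def if_distrib cong: if_cong)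
  have "blinfun_apply (\<phi>' i) (chi l) = (\<Sum>j\<in>C. M i j * W l j)"
    using i measure_gamblet_sum[OF C \<phi>]
    by (simp add: nested blinfun.sum_left blinfun.scaleR_left chi_def)
  also have "\<dots> = fmat_apply R C M (fmat_apply C J (fmat_transpose W) ?e) i"
    using i row by (simp add: fmat_apply_def[of R])
  also have "\<dots> = 0" using ker by (simp add: fmat_kernel_def)
  finally show ?thesis .
qed

text \<open>This uses the other inclusion between image and kernel: the fine measurements of
  \<open>x\<close> form a kernel vector, so they combine the rows of \<open>W\<close>, and the same
  coefficients express \<open>x\<close> through \<open>chi\<close>.\<close>

lemma in_span_chi:
  assumes x: "x \<in> meas_space C \<phi>" and 0: "\<And>i. i \<in> R \<Longrightarrow> blinfun_apply (\<phi>' i) x = 0"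
  shows "x \<in> span (chi ` J)"
proof -
  let ?c = "\<lambda>j. if j \<in> C then blinfun_apply (\<phi> j) x else 0"
  have "(\<Sum>j\<in>C. M i j * ?c j) = 0" if "i \<in> R" for i
    using 0[OF that] that by (simp add: nested blinfun.sum_left blinfun.scaleR_left)
  then have "?c \<in> fmat_kernel R C M"
    by (auto simp: fmat_kernel_def coord_space_def fmat_apply_def fun_eq_iff)
  then obtain d where d: "?c = fmat_apply C J (fmat_transpose W) d"
    unfolding image_eq_kernel[symmetric] fmat_image_def by blast
  have cd: "blinfun_apply (\<phi> j) x = (\<Sum>l\<in>J. d l * W l j)" if "j \<in> C" for j
    using fun_cong[OF d, of j] that
    by (simp add: fmat_apply_def fmat_transpose_def mult.commute)
  have "x = (\<Sum>j\<in>C. blinfun_apply (\<phi> j) x *\<^sub>R gamblet C \<phi> j)"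
    using gamblet_approx_of_meas_space[OF C \<phi> x] by (simp add: gamblet_approx_def)
  also have "\<dots> = (\<Sum>j\<in>C. \<Sum>l\<in>J. (d l * W l j) *\<^sub>R gamblet C \<phi> j)"
    using cd by (simp add: scaleR_sum_left)
  also have "\<dots> = (\<Sum>l\<in>J. d l *\<^sub>R chi l)"
    by (subst sum.swap) (simp add: chi_def scaleR_sum_right)
  also have "\<dots> \<in> span (chi ` J)" by (rule sum_in_span_image)
  finally show ?thesis .
qed

text \<open>Both approximations reproduce the coarse measurements of \<open>u\<close>, so these
  cancel in the difference.\<close>

lemma increment_in_span_chi:
  "gamblet_approx C \<phi> u - gamblet_approx R \<phi>' u \<in> span (chi ` J)"
proof (rule in_span_chi)
  have *: "gamblet_approx C \<phi> u \<in> meas_space C \<phi>" "gamblet_approx R \<phi>' u \<in> meas_space R \<phi>'"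
    using orth_proj_gamblet_approx[OF C \<phi>] orth_proj_gamblet_approx[OF R \<phi>']
    by (auto simp: orth_proj_def)
  then show "gamblet_approx C \<phi> u - gamblet_approx R \<phi>' u \<in> meas_space C \<phi>"
    using meas_space_mono[where \<phi>' = \<phi>' and M = M and \<phi> = \<phi>, OF nested] by (intro span_diff) auto
  fix i assume i: "i \<in> R"
  have "blinfun_apply (\<phi>' i) (gamblet_approx C \<phi> u) = blinfun_apply (\<phi>' i) u"
    using i measure_gamblet_sum[OF C \<phi>]
    by (simp add: nested blinfun.sum_left blinfun.scaleR_left gamblet_approx_def)
  moreover have "blinfun_apply (\<phi>' i) (gamblet_approx R \<phi>' u) = blinfun_apply (\<phi>' i) u"
    using i measure_gamblet_sum[OF R \<phi>'] by (simp add: gamblet_approx_def)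
  ultimately show "blinfun_apply (\<phi>' i) (gamblet_approx C \<phi> u - gamblet_approx R \<phi>' u) = 0"
    by (simp add: blinfun.diff_right)
qed

text \<open>The vectors \<^term>\<open>chi l\<close> together with the coarse \<^term>\<open>Q (\<phi>' i)\<close> span the fine space and
  are just as many as its dimension.\<close>

lemma lin_indep_family_chi: "lin_indep_family J chi"
proof (rule lin_indep_family_Plus_left)
  show "lin_indep_family (J <+> R) (case_sum chi (\<lambda>i. Q (\<phi>' i)))"
  proof (rule lin_indep_family_if_spans)
    show "finite (J <+> R)" using J R by simp
    show "lin_indep_family C (gamblet C \<phi>)" by (rule lin_indep_family_gamblet[OF C \<phi>])
    show "card (J <+> R) \<le> card C" using cards J R by (simp add: card_Plus)
    let ?V = "case_sum chi (\<lambda>i. Q (\<phi>' i)) ` (J <+> R)"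
    have V: "?V = chi ` J \<union> (\<lambda>i. Q (\<phi>' i)) ` R"
      by (force simp: Plus_def)
    show "gamblet C \<phi> ` C \<subseteq> span ?V"
    proof safe
      fix i assume i: "i \<in> C"
      define x where "x = gamblet C \<phi> i"
      \<comment> \<open>Splitting a fine gamblet as \<open>(x - y) + y\<close> gives an increment in
        the span of \<open>chi\<close> and a coarse part.\<close>
      define y where "y = gamblet_approx R \<phi>' x"
      have "x \<in> meas_space C \<phi>" unfolding x_def by (rule gamblet_in_meas_space[OF C \<phi> i])
      then have "x - y \<in> span (chi ` J)"
        using increment_in_span_chi[of x] gamblet_approx_of_meas_space[OF C \<phi>] by (simp add: y_def)
      moreover have "y \<in> meas_space R \<phi>'"
        unfolding y_def using orth_proj_gamblet_approx[OF R \<phi>'] by (simp add: orth_proj_def)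
      ultimately have "(x - y) + y \<in> span ?V"
        unfolding V by (intro span_add) (auto intro: subsetD[OF span_mono, rotated])
      then show "gamblet C \<phi> i \<in> span ?V" by (simp add: x_def)
    qed
  qed
qed

text \<open>Against each \<open>chi l\<close>, the fine approximation has the same inner product as
  \<open>u\<close>, while the coarse one contributes zero.\<close>

lemma orth_proj_increment:
  "orth_proj (span (chi ` J)) u (gamblet_approx C \<phi> u - gamblet_approx R \<phi>' u)"
proof (rule orth_proj_spanI[OF increment_in_span_chi])
  fix t assume "t \<in> chi ` J"
  then obtain l where l: "l \<in> J" "t = chi l" by auto
  have "ip x t = 0" if "x \<in> meas_space R \<phi>'" for x
    using that by (induction rule: span_induct_alt) (use measure_chi l in \<open>auto simp: ip_Q\<close>)
  then have "ip t (gamblet_approx R \<phi>' u) = 0"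
    using orth_proj_gamblet_approx[OF R \<phi>'] by (subst ip_commute) (auto simp: orth_proj_def)
  moreover have "ip t (gamblet_approx C \<phi> u) = ip t u"
    using orth_proj_gamblet_approx[OF C \<phi>] chi_in_meas_space l by (auto simp: orth_proj_def)
  ultimately show "ip t (gamblet_approx C \<phi> u - gamblet_approx R \<phi>' u) = ip t u" by simp
qed

end

section \<open>Counting children in the tree and independence at every level\<close>

lemma trunc_level:
  fixes I :: "(nat \<Rightarrow> 'i) set"
  shows "trunc k ` level I (Suc k) = level I k"
proof -
  have "trunc k (trunc (Suc k) i) = trunc k i" for i :: "nat \<Rightarrow> 'i"
    by (auto simp: trunc_def)
  then show ?thesis by (simp add: level_def image_image)
qed

text \<open>Both sets are counted fibrewise over the parents in \<open>level I k\<close>; each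
  parent accounts for a difference of one.\<close>

lemma card_orthogonalization:
  fixes I :: "(nat \<Rightarrow> 'i) set"
  assumes f: "finite (level I (Suc k))" and J: "finite J" "trunc k ` J = level I k"
    and fibre: "\<And>i. i \<in> level I k \<Longrightarrow>
      card {j \<in> J. trunc k j = i} = card {t \<in> level I (Suc k). trunc k t = i} - 1"
  shows "card J + card (level I k) = card (level I (Suc k))"
proof -
  have count: "card S = (\<Sum>i\<in>trunc k ` S. card {j \<in> S. trunc k j = i})" if "finite S"
    for S :: "(nat \<Rightarrow> 'i) set"
    using sum.image_gen[OF that, of "\<lambda>_. 1::nat" "trunc k"] by simp
  have pos: "card {t \<in> level I (Suc k). trunc k t = i} \<ge> 1" if "i \<in> level I k" for i
  proof -
    have "{t \<in> level I (Suc k). trunc k t = i} \<noteq> {}"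
      using that trunc_level[of k I] by (metis (mono_tags, lifting) empty_iff imageE mem_Collect_eq)
    then show ?thesis using f by (simp add: Suc_le_eq card_gt_0_iff)
  qed
  have "card J + card (level I k) = (\<Sum>i\<in>level I k. card {j \<in> J. trunc k j = i} + 1)"
    using count[OF J(1)] J(2) by (simp only: sum.distrib sum_constant) simp
  also have "\<dots> = (\<Sum>i\<in>level I k. card {t \<in> level I (Suc k). trunc k t = i})"
  proof (rule sum.cong)
    fix i assume "i \<in> level I k"
    then show "card {j \<in> J. trunc k j = i} + 1 = card {t \<in> level I (Suc k). trunc k t = i}"
      using fibre[of i] pos[of i] by linarith
  qed simp
  also have "\<dots> = card (level I (Suc k))"
    using count[OF f] by (simp add: trunc_level)
  finally show ?thesis .
qed

text \<open>For finite depth, independence is given at the finest level and descends through the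
  full-rank matrices; for infinite depth it is given at each level.\<close>

lemma measurement_hierarchy_lin_indep:
  assumes tree: "index_tree q I" and h: "measurement_hierarchy q I \<pi> \<phi>"
    and k: "1 \<le> k" "enat k \<le> q"
  shows "lin_indep_family (level I k) (\<phi> k)"
proof (cases q)
  case (enat n)
  then have "k \<le> n" using k by simp
  then show ?thesis
  proof (induction rule: inc_induct)
    case base
    show ?case using h enat by (simp add: measurement_hierarchy_def)
  next
    case (step m)
    then have m: "1 \<le> m" "enat m < q" "enat (Suc m) \<le> q" "enat m \<le> q"
      using k enat by auto
    show ?case
    proof (rule lin_indep_family_fmat)
      show "finite (level I m)" "finite (level I (Suc m))"
        using tree m by (auto simp: index_tree_def)
      show "fmat_rank (level I m) (level I (Suc m)) (\<pi> m) = card (level I m)"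
        and "\<And>i. i \<in> level I m \<Longrightarrow> \<phi> m i = (\<Sum>j\<in>level I (Suc m). \<pi> m i j *\<^sub>R \<phi> (Suc m) j)"
        using h m by (auto simp: measurement_hierarchy_def)
    qed fact
  qed
next
  case infinity
  then show ?thesis using h k by (simp add: measurement_hierarchy_def)
qed

section \<open>First level, increments, telescoping and the limit\<close>

theorem theorem3p22:
  fixes Q :: "'a::banach dual \<Rightarrow> 'a"
    and q :: enat
    and I :: "(nat \<Rightarrow> 'i) set"
    and \<pi> :: "nat \<Rightarrow> (nat \<Rightarrow> 'i) \<Rightarrow> (nat \<Rightarrow> 'i) \<Rightarrow> real"
    and \<phi> :: "nat \<Rightarrow> (nat \<Rightarrow> 'i) \<Rightarrow> 'a dual"
    and J :: "nat \<Rightarrow> (nat \<Rightarrow> 'i) set"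
    and W :: "nat \<Rightarrow> (nat \<Rightarrow> 'i) \<Rightarrow> (nat \<Rightarrow> 'i) \<Rightarrow> real"
    and \<psi> chi :: "nat \<Rightarrow> (nat \<Rightarrow> 'i) \<Rightarrow> 'a"
    and A B :: "nat \<Rightarrow> (nat \<Rightarrow> 'i) \<Rightarrow> (nat \<Rightarrow> 'i) \<Rightarrow> real"
    and b w :: "nat \<Rightarrow> (nat \<Rightarrow> 'i) \<Rightarrow> real"
    and u :: 'a
    and v :: "nat \<Rightarrow> 'a"
  assumes separable: "separable_space (euclidean :: 'a topology)"
    and reflexive: "reflexive_space TYPE('a)"
    and norm: "quadratic_norm Q"
    and depth: "1 \<le> q"
    and tree: "index_tree q I"
    and hierarchy: "measurement_hierarchy q I \<pi> \<phi>"
    and orth: "orthogonalization_system q I \<pi> J W"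
    and psi: "\<And>k i. \<psi> k i = gamblet (level I k) (\<phi> k) i"
    and chi_eq: "\<And>k i. chi k i = (\<Sum>j\<in>level I k. W k i j *\<^sub>R \<psi> k j)"
    and A: "\<And>k i j. A k i j = energy_inner Q (\<psi> k i) (\<psi> k j)"
    and B: "\<And>k i j. B k i j = energy_inner Q (chi k i) (chi k j)"
    and b: "\<And>k i. b k i = energy_inner Q (\<psi> k i) u"
    and w1: "w 1 = fmat_solution (level I 1) (A 1) (b 1)"
    and v1: "v 1 = (\<Sum>i\<in>level I 1. w 1 i *\<^sub>R \<psi> 1 i)"
    and wk: "\<And>k. 2 \<le> k \<Longrightarrow> enat k \<le> q \<Longrightarrow>
               w k = fmat_solution (J k) (B k) (fmat_apply (J k) (level I k) (W k) (b k))"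
    and vk: "\<And>k. 2 \<le> k \<Longrightarrow> enat k \<le> q \<Longrightarrow> v k = (\<Sum>i\<in>J k. w k i *\<^sub>R chi k i)"
  shows "(case q of
            enat n \<Rightarrow> gamblet_approx (level I n) (\<phi> n) u = (\<Sum>k = 1..n. v k)
          | \<infinity> \<Rightarrow> convergent (\<lambda>k. gamblet_approx (level I k) (\<phi> k) u) \<and>
                (\<lambda>k. v (Suc k)) sums lim (\<lambda>k. gamblet_approx (level I k) (\<phi> k) u)) \<and>
         v 1 = gamblet_approx (level I 1) (\<phi> 1) u \<and>
         (\<forall>k\<ge>2. enat k \<le> q \<longrightarrow>
            v k = gamblet_approx (level I k) (\<phi> k) u
                  - gamblet_approx (level I (k - 1)) (\<phi> (k - 1)) u)"
proof -
  interpret quadratic_space Q by unfold_locales (rule norm)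
  let ?P = "\<lambda>k. gamblet_approx (level I k) (\<phi> k) u"
  let ?V = "\<lambda>k. meas_space (level I k) (\<phi> k)"
  have fin: "finite (level I k)" and ind: "lin_indep_family (level I k) (\<phi> k)"
    if "1 \<le> k" "enat k \<le> q" for k
    using tree that measurement_hierarchy_lin_indep[OF tree hierarchy that]
    by (auto simp: index_tree_def)
  have nested: "\<phi> k i = (\<Sum>j\<in>level I (Suc k). \<pi> k i j *\<^sub>R \<phi> (Suc k) j)"
    if "1 \<le> k" "enat (Suc k) \<le> q" "i \<in> level I k" for k i
    using hierarchy that by (auto simp: measurement_hierarchy_def Suc_ile_eq)
  have P: "orth_proj (?V k) u (?P k)" if "1 \<le> k" "enat k \<le> q" for k
    by (rule orth_proj_gamblet_approx[OF fin[OF that] ind[OF that]])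
  have psi': "\<psi> k = gamblet (level I k) (\<phi> k)" for k
    by (rule ext) (rule psi)
  have q1: "enat 1 \<le> q" using depth by (simp add: one_enat_def)
  \<comment> \<open>\<open>A 1\<close> is the Gram matrix of the first-level gamblets, whose span is
    \<open>?V 1\<close>.\<close>
  have "orth_proj (span (\<psi> 1 ` level I 1)) u (v 1)"
    unfolding v1 w1
  proof (rule orth_proj_gram)
    show "lin_indep_family (level I 1) (\<psi> 1)"
      unfolding psi' using lin_indep_family_gamblet[OF fin ind] q1 by simp
  qed (use fin q1 A b in auto)
  then have "orth_proj (?V 1) u (v 1)"
    unfolding psi' using span_gamblet[OF fin ind] q1 by simp
  then have first: "v 1 = ?P 1"
    using orth_proj_unique[OF subspace_span] P[of 1] q1 by blast
  have increment: "v (Suc k) = ?P (Suc k) - ?P k" if k: "1 \<le> k" "enat (Suc k) \<le> q" for k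
  proof -
    have k': "enat k \<le> q" using k(2) by (meson enat_ord_simps(1) le_SucI order.refl order.trans)
    have Suc2: "2 \<le> Suc k" using k by simp
    from orth[unfolded orthogonalization_system_def, rule_format, OF Suc2 k(2)]
    have J: "finite (J (Suc k))" "trunc k ` J (Suc k) = level I k"
      and fibre: "\<And>i. i \<in> level I k \<Longrightarrow> card {j \<in> J (Suc k). trunc k j = i} =
        card {t \<in> level I (Suc k). trunc k t = i} - 1"
      and im: "fmat_image (level I (Suc k)) (J (Suc k)) (fmat_transpose (W (Suc k))) =
        fmat_kernel (level I k) (level I (Suc k)) (\<pi> k)"
      by auto
    have finS: "finite (level I (Suc k))" using fin k by simp
    interpret st: gamblet_step Q "level I k" "level I (Suc k)" "J (Suc k)" "\<pi> k" "W (Suc k)"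
      "\<phi> k" "\<phi> (Suc k)"
    proof unfold_locales
      show "card (J (Suc k)) + card (level I k) = card (level I (Suc k))"
        by (rule card_orthogonalization[OF finS J fibre])
    qed (use fin ind nested J im k k' in auto)
    have chi: "chi (Suc k) = st.chi"
      by (rule ext) (simp add: chi_eq st.chi_def psi')
    have "orth_proj (span (chi (Suc k) ` J (Suc k))) u (v (Suc k))"
      unfolding vk[OF Suc2 k(2)] wk[OF Suc2 k(2)]
    proof (rule orth_proj_gram[OF J(1)])
      show "lin_indep_family (J (Suc k)) (chi (Suc k))"
        unfolding chi by (rule st.lin_indep_family_chi)
      show "fmat_apply (J (Suc k)) (level I (Suc k)) (W (Suc k)) (b (Suc k)) i =
          ip (chi (Suc k) i) u" if "i \<in> J (Suc k)" for i
        using that by (simp add: fmat_apply_def chi_eq b)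
    qed (rule B)
    then show ?thesis
      using orth_proj_unique[OF subspace_span _ st.orth_proj_increment] unfolding chi by blast
  qed
  have partial: "(\<Sum>k = 1..n. v k) = ?P n" if "1 \<le> n" "enat n \<le> q" for n
    using that
  proof (induction n rule: dec_induct)
    case base
    show ?case using first by simp
  next
    case (step n)
    then have "enat n \<le> q" by (meson enat_ord_simps(1) le_SucI order.refl order.trans)
    with step increment[of n] show ?case by simp
  qed
  have "case q of enat n \<Rightarrow> ?P n = (\<Sum>k = 1..n. v k)
      | \<infinity> \<Rightarrow> convergent ?P \<and> (\<lambda>k. v (Suc k)) sums lim ?P"
  proof (cases q)
    case (enat n)
    then show ?thesis using partial[of n] q1 by simp
  next
    case infinity
    \<comment> \<open>The shift starts the sequence at level 1, since the hypotheses say nothing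
      about level 0.\<close>
    have "Cauchy (\<lambda>n. ?P (Suc n))"
    proof (rule Cauchy_orth_proj[where V = "\<lambda>n. ?V (Suc n)"])
      show "?V (Suc n) \<subseteq> ?V (Suc (Suc n))" for n
        using infinity by (intro meas_space_mono[where M = "\<pi> (Suc n)"] nested) auto
      show "orth_proj (?V (Suc n)) u (?P (Suc n))" for n
        using infinity by (intro P) auto
    qed
    then have conv: "convergent ?P"
      using Cauchy_convergent convergent_Suc_iff[of ?P] by blast
    have "(\<lambda>n. ?P (Suc n)) \<longlonglongrightarrow> lim ?P"
      by (rule LIMSEQ_Suc[OF conv[unfolded convergent_LIMSEQ_iff]])
    \<comment> \<open>Only nonempty partial sums are compared: the empty one is zero, whereas
      \<open>?P 0\<close> is unconstrained. Hence the shift in the limit below.\<close>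
    moreover have "(\<Sum>k<Suc n. v (Suc k)) = ?P (Suc n)" for n
      using partial[of "Suc n"] infinity sum.atLeast1_atMost_eq[of v "Suc n"] by simp
    ultimately have "(\<lambda>k. v (Suc k)) sums lim ?P"
      unfolding sums_def by (subst filterlim_sequentially_Suc[symmetric]) simp
    with conv infinity show ?thesis by simp
  qed
  moreover have "v k = ?P k - ?P (k - 1)" if "k \<ge> 2" "enat k \<le> q" for k
    using increment[of "k - 1"] that by simp
  ultimately show ?thesis using first by blast
qed

end
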